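(* Let $p$ be an odd prime. Then there exists a non-abelian $p$-group $P$ of order $p^5$ with $\mathcal{CD}(P) = \{\mathrm{Z}(P), P\}$.
   Context: For a finite group $G$ and a subgroup $U \le G$, the Chermak-Delgado measure of $U$ in $G$ is $m_G(U) = |U|\,|C_G(U)|$. Put $m(G) = \max\{m_G(U) \mid U \le G\}$ and $\mathcal{CD}(G) = \{U \le G \mid m_G(U) = m(G)\}$, the Chermak-Delgado lattice of $G$. $\mathrm{Z}(P)$ denotes the center of $P$. *)

theory Defs
  imports "HOL-Algebra.Coset" "HOL-Computational_Algebra.Primes"
begin

definition centralizer :: "('a, 'b) monoid_scheme \<Rightarrow> 'a set \<Rightarrow> 'a set"
  where "centralizer G U =
    {g \<in> carrier G. \<forall>u\<in>U. g \<otimes>\<^bsub>G\<^esub> u = u \<otimes>\<^bsub>G\<^esub> g}"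

definition center :: "('a, 'b) monoid_scheme \<Rightarrow> 'a set"
  where "center G = centralizer G (carrier G)"

definition cd_measure :: "('a, 'b) monoid_scheme \<Rightarrow> 'a set \<Rightarrow> nat"
  where "cd_measure G U = card U * card (centralizer G U)"

text \<open>The following two definitions are only meaningful for finite groups, where the
  maximum is taken over a finite nonempty set.\<close>

definition cd_max :: "('a, 'b) monoid_scheme \<Rightarrow> nat"
  where "cd_max G = Max {cd_measure G U | U. subgroup U G}"

definition cd_lattice :: "('a, 'b) monoid_scheme \<Rightarrow> 'a set set"
  where "cd_lattice G = {U. subgroup U G \<and> cd_measure G U = cd_max G}"

end

theory Submission
  imports Defs "HOL-Algebra.Weak_Morphisms" "HOL-Library.Countable"
begin

text \<open>
  If every non-central element of a finite group \<open>G\<close> has a centralizer \<open>C\<close> with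
  \<open>|C|\<^sup>2 < |G| |Z(G)|\<close>, then the Chermak-Delgado lattice is \<open>{Z(G), G}\<close>: when both \<open>U\<close> and
  its centralizer contain non-central elements \<open>x\<close> and \<open>y\<close>, then \<open>U \<subseteq> C(y)\<close> and
  \<open>C(U) \<subseteq> C(x)\<close>, so the measure of \<open>U\<close> is too small. The free
  nilpotent group of class 3 on two generators, taken over \<open>\<F>\<^sub>p\<close>, has this property: two of its elements
  commute iff their images in \<open>\<F>\<^sub>p\<^sup>3\<close> modulo the center are linearly dependent, so the centralizers of
  non-central elements have order \<open>p\<^sup>3\<close>.
\<close>

section \<open>Centralizers, the center and a criterion for the smallest possible lattice\<close>

lemma centralizer_subset_carrier: "centralizer G U \<subseteq> carrier G"
  by (auto simp: centralizer_def)

lemma centralizer_antimono: "U \<subseteq> V \<Longrightarrow> centralizer G V \<subseteq> centralizer G U"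
  by (auto simp: centralizer_def)

lemma center_subset_centralizer: "U \<subseteq> carrier G \<Longrightarrow> center G \<subseteq> centralizer G U"
  unfolding center_def by (rule centralizer_antimono)

lemma centralizer_eq_carrier: "U \<subseteq> center G \<Longrightarrow> centralizer G U = carrier G"
  by (fastforce simp: centralizer_def center_def)

lemma (in group) subgroup_center: "subgroup (center G) G"
proof (rule subgroupI)
  show "center G \<subseteq> carrier G"
    unfolding center_def by (rule centralizer_subset_carrier)
  show "center G \<noteq> {}"
    by (auto simp: center_def centralizer_def intro!: exI[of _ \<one>])
next
  fix a assume a: "a \<in> center G"
  then have ca: "a \<in> carrier G" by (auto simp: center_def centralizer_def)
  show "inv a \<in> center G"
    unfolding center_def centralizer_def
  proof safe
    fix u assume u: "u \<in> carrier G"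
    with a have "a \<otimes> u = u \<otimes> a" by (auto simp: center_def centralizer_def)
    with u ca have "inv a \<otimes> (u \<otimes> a) = u" by (simp add: inv_solve_left')
    with u ca show "inv a \<otimes> u = u \<otimes> inv a"
      by (simp add: inv_solve_right m_assoc)
  qed (use ca in simp)
next
  fix a b assume "a \<in> center G" "b \<in> center G"
  then have ab: "a \<in> carrier G" "b \<in> carrier G"
    and com: "\<And>u. u \<in> carrier G \<Longrightarrow> a \<otimes> u = u \<otimes> a" "\<And>u. u \<in> carrier G \<Longrightarrow> b \<otimes> u = u \<otimes> b"
    by (auto simp: center_def centralizer_def)
  have "a \<otimes> b \<otimes> u = u \<otimes> (a \<otimes> b)" if "u \<in> carrier G" for u
  proof -
    have "a \<otimes> b \<otimes> u = a \<otimes> u \<otimes> b" using ab that by (simp add: m_assoc com(2))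
    also have "\<dots> = u \<otimes> (a \<otimes> b)" using ab that by (simp add: m_assoc com(1))
    finally show ?thesis .
  qed
  with ab show "a \<otimes> b \<in> center G"
    by (simp add: center_def centralizer_def)
qed

lemma (in group) cd_lattice_eq_center_carrier:
  assumes fin: "finite (carrier G)"
    and small: "\<And>x. x \<in> carrier G - center G \<Longrightarrow> card (centralizer G {x}) \<le> k"
    and less: "k * k < order G * card (center G)"
  shows "cd_lattice G = {center G, carrier G}"
proof -
  let ?m = "order G * card (center G)"
  note Z = subgroup_center
  have Zsub: "center G \<subseteq> carrier G" using Z by (rule subgroup.subset)
  have finZ: "finite (center G)" using Zsub fin by (rule finite_subset)
  have posG: "order G > 0" using less by (cases "order G = 0") auto
  have posZ: "card (center G) > 0" using less by (cases "card (center G) = 0") auto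
  have max: "cd_measure G U \<le> ?m \<and>
      (cd_measure G U = ?m \<longleftrightarrow> U = center G \<or> U = carrier G)" if "U \<subseteq> carrier G" for U
  proof -
    have finU: "finite U" using that fin by (rule finite_subset)
    have finC: "finite (centralizer G V)" for V
      using centralizer_subset_carrier fin by (rule finite_subset)
    \<comment> \<open>Cases 1 and 2 are symmetric: there \<open>centralizer G U\<close> is all of
      \<open>G\<close>, respectively exactly the center, so only the factor \<open>card U\<close>
      remains to be compared. Case 3 yields the bound \<open>k * k\<close>.\<close>
    consider (1) "U \<subseteq> center G" | (2) "centralizer G U \<subseteq> center G"
      | (3) x y where "x \<in> U" "x \<notin> center G" "y \<in> centralizer G U" "y \<notin> center G"
      by blast
    then show ?thesis
    proof cases
      case 1
      have "card U \<le> card (center G)" using finZ 1 by (rule card_mono)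
      moreover have "card U = card (center G) \<longleftrightarrow> U = center G"
        using card_subset_eq[OF finZ 1] by auto
      \<comment> \<open>If a central \<open>U\<close> is the whole group, the two alternatives of
        the claim coincide.\<close>
      moreover have "U = center G" if "U = carrier G" using that 1 Zsub by blast
      ultimately show ?thesis
        using posG unfolding cd_measure_def centralizer_eq_carrier[OF 1] order_def by auto
    next
      case 2
      then have C: "centralizer G U = center G"
        using center_subset_centralizer[OF that] by blast
      have "card U \<le> order G" unfolding order_def using fin that by (rule card_mono)
      moreover have "card U = order G \<longleftrightarrow> U = carrier G"
        unfolding order_def using card_subset_eq[OF fin that] by auto
      moreover have "U = carrier G" if "U = center G"
        using centralizer_eq_carrier[of U G] that C by simp
      ultimately show ?thesis
        using posZ unfolding cd_measure_def C by auto
    next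
      case 3
      have y: "y \<in> carrier G" using 3(3) by (simp add: centralizer_def)
      have "U \<subseteq> centralizer G {y}"
        using 3(3) that by (force simp: centralizer_def)
      then have "card U \<le> card (centralizer G {y})" by (rule card_mono[OF finC])
      also have "\<dots> \<le> k" using small y 3 by blast
      finally have "card U \<le> k" .
      moreover have "card (centralizer G U) \<le> card (centralizer G {x})"
        using 3(1) by (intro card_mono finC centralizer_antimono) auto
      then have "card (centralizer G U) \<le> k"
        using small[of x] 3 that by fastforce
      ultimately have "cd_measure G U \<le> k * k"
        unfolding cd_measure_def by (rule mult_le_mono)
      then have "cd_measure G U < ?m" using less by linarith
      moreover have "cd_measure G (center G) = ?m" "cd_measure G (carrier G) = ?m"
        using centralizer_eq_carrier[of "center G" G]
        by (simp_all add: cd_measure_def order_def flip: center_def)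
      ultimately show ?thesis by auto
    qed
  qed
  have "cd_max G = ?m"
    unfolding cd_max_def
  proof (rule Max_eqI)
    have "{cd_measure G U | U. subgroup U G} \<subseteq> {..?m}"
      using max subgroup.subset by blast
    then show "finite {cd_measure G U | U. subgroup U G}"
      by (rule finite_subset) simp
    show "?m \<in> {cd_measure G U | U. subgroup U G}"
      using Z max[OF Zsub] by force
  qed (use max subgroup.subset in blast)
  then have "cd_measure G U = cd_max G \<longleftrightarrow> U = center G \<or> U = carrier G"
    if "subgroup U G" for U
    using max[OF subgroup.subset[OF that]] by simp
  then have "cd_lattice G = {U. subgroup U G \<and> (U = center G \<or> U = carrier G)}"
    unfolding cd_lattice_def by (intro Collect_cong) blast
  also have "\<dots> = {center G, carrier G}"
    using Z subgroup_self by auto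
  finally show ?thesis .
qed

section \<open>Renaming the elements of a group along an injection\<close>

lemma (in group) group_image_group:
  assumes "inj_on f (carrier G)"
  shows "group (image_group f G)"
  using iso_imp_img_group[OF inj_imp_image_group_iso[OF assms]] by (simp add: image_group_def)

text \<open>Injectivity makes renamed products agree exactly when the original ones do, so the
  commutation relation is carried over unchanged.\<close>

lemma (in monoid) centralizer_image_group:
  assumes f: "inj_on f (carrier G)" and "U \<subseteq> carrier G"
  shows "centralizer (image_group f G) (f ` U) = f ` centralizer G U"
proof -
  have "f x \<otimes>\<^bsub>image_group f G\<^esub> f y = f (x \<otimes> y)" if "x \<in> carrier G" "y \<in> carrier G" for x y
    using that f by (simp add: image_group_def)
  moreover have "f (x \<otimes> y) = f (y \<otimes> x) \<longleftrightarrow> x \<otimes> y = y \<otimes> x"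
    if "x \<in> carrier G" "y \<in> carrier G" for x y
    using that f by (auto dest: inj_onD)
  ultimately show ?thesis
    using assms(2) by (auto simp: centralizer_def image_group_carrier subset_iff)
qed

lemma (in monoid) center_image_group:
  assumes "inj_on f (carrier G)"
  shows "center (image_group f G) = f ` center G"
  unfolding center_def image_group_carrier by (rule centralizer_image_group[OF assms subset_refl])

section \<open>A group of order \<open>p ^ 5\<close> and class 3\<close>

text \<open>
  Embed the free nilpotent group of class 3 on two generators \<open>X, Y\<close> into the truncated tensor
  algebra, and let \<open>c\<^sub>w\<close> be the coefficient of the word \<open>w\<close>. The coordinates below are
  \<open>x = c\<^sub>X\<close>, \<open>y = c\<^sub>Y\<close>, \<open>z = 2 c\<^sub>X\<^sub>Y - x y\<close>, \<open>d = 2 c\<^sub>X\<^sub>X\<^sub>Y\<close> and \<open>e = 2 c\<^sub>X\<^sub>Y\<^sub>Y\<close>. They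
  avoid all denominators, so that \<open>p = 3\<close> is not an exception.
\<close>

definition class3_group :: "nat \<Rightarrow> (int \<times> int \<times> int \<times> int \<times> int) monoid" where
  "class3_group p =
    \<lparr>carrier = {0..<int p} \<times> {0..<int p} \<times> {0..<int p} \<times> {0..<int p} \<times> {0..<int p},
     monoid.mult = (\<lambda>(x, y, z, d, e) (x', y', z', d', e').
       ((x + x') mod int p,
        (y + y') mod int p,
        (z + z' + x * y' - x' * y) mod int p,
        (d + d' + x * z' + x * y' * (x + x')) mod int p,
        (e + e' + z * y' + x * y' * (y + y')) mod int p)),
     one = (0, 0, 0, 0, 0)\<rparr>"

text \<open>
  These rules strip the inner reductions one by one, while unification builds
  the unreduced polynomial; the simplifier rules \<open>mod_simps\<close> do not reach a reduction inside
  a product that is itself a summand.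
\<close>

lemma mod_eqI:
  assumes "a mod m = a' mod m" "b mod m = b' mod m" "a' = b'"
  shows "a mod m = b mod m"
  using assms by simp

lemma mod_eq_0I:
  fixes a a' m :: "'a :: semidom_modulo"
  assumes "a mod m = a' mod m" "a' = 0"
  shows "a mod m = 0"
  using assms by simp

lemma mod_modI:
  fixes a a' m :: "'a :: euclidean_semiring_cancel"
  assumes "a mod m = a' mod m"
  shows "(a mod m) mod m = a' mod m"
  using assms by simp

lemma group_class3_group:
  assumes "p > 0"
  shows "group (class3_group p)"
proof (rule groupI)
  fix s t u :: "int \<times> int \<times> int \<times> int \<times> int"
  assume "s \<in> carrier (class3_group p)" "t \<in> carrier (class3_group p)"
    "u \<in> carrier (class3_group p)"
  obtain x y z d e x' y' z' d' e' x'' y'' z'' d'' e''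
    where eqs: "s = (x, y, z, d, e)" "t = (x', y', z', d', e')" "u = (x'', y'', z'', d'', e'')"
    by (metis prod_cases5)
  show "s \<otimes>\<^bsub>class3_group p\<^esub> t \<otimes>\<^bsub>class3_group p\<^esub> u
      = s \<otimes>\<^bsub>class3_group p\<^esub> (t \<otimes>\<^bsub>class3_group p\<^esub> u)"
    unfolding eqs class3_group_def monoid.simps prod.case prod.inject
    by (intro conjI; rule mod_eqI,
        (rule mod_modI mod_add_cong mod_diff_cong mod_mult_cong refl)+, simp add: algebra_simps)
next
  fix s :: "int \<times> int \<times> int \<times> int \<times> int"
  assume s: "s \<in> carrier (class3_group p)"
  obtain x y z d e where eq: "s = (x, y, z, d, e)" by (metis prod_cases5)
  \<comment> \<open>Once the first two coordinates are \<open>- x\<close> and \<open>- y\<close>,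
    the cubic terms contain a vanishing factor, and the last two coordinates solve linear
    equations.\<close>
  let ?t = "(- x mod int p, - y mod int p, - z mod int p, (x * z - d) mod int p, (z * y - e) mod int p)"
  have "?t \<otimes>\<^bsub>class3_group p\<^esub> s = \<one>\<^bsub>class3_group p\<^esub>"
    unfolding eq class3_group_def monoid.simps prod.case prod.inject
    by (intro conjI; rule mod_eq_0I,
        (rule mod_modI mod_add_cong mod_diff_cong mod_mult_cong refl)+, simp add: algebra_simps)
  moreover have "?t \<in> carrier (class3_group p)"
    using assms by (simp add: class3_group_def)
  ultimately show "\<exists>t\<in>carrier (class3_group p). t \<otimes>\<^bsub>class3_group p\<^esub> s = \<one>\<^bsub>class3_group p\<^esub>"
    by blast
qed (use assms in \<open>auto simp: class3_group_def\<close>)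

text \<open>The third coordinates of the two products differ by \<open>2 * ?D\<close>, and
  \<open>2\<close> is invertible modulo an odd \<open>p\<close>. The last two coordinates differ by
  the other two minors, up to multiples of \<open>?D\<close>. Vanishing of all three minors is
  linear dependence modulo \<open>p\<close>.\<close>

lemma class3_group_commute_iff:
  assumes "odd p"
  shows "(x, y, z, d, e) \<otimes>\<^bsub>class3_group p\<^esub> (x', y', z', d', e')
      = (x', y', z', d', e') \<otimes>\<^bsub>class3_group p\<^esub> (x, y, z, d, e) \<longleftrightarrow>
    int p dvd x * y' - x' * y \<and> int p dvd x * z' - x' * z \<and> int p dvd z * y' - z' * y"
    (is "?L \<longleftrightarrow> ?D \<and> ?E \<and> ?F")
proof -
  let ?D = "x * y' - x' * y"
  have "?L \<longleftrightarrow> int p dvd 2 * ?D \<and> int p dvd (x * z' - x' * z) + (x + x') * ?D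
      \<and> int p dvd (z * y' - z' * y) + (y + y') * ?D"
    unfolding class3_group_def by (simp add: mod_eq_dvd_iff) (simp add: algebra_simps)
  moreover have "int p dvd 2 * ?D \<longleftrightarrow> int p dvd ?D"
    using assms by (intro coprime_dvd_mult_right_iff) simp
  ultimately show ?thesis by (auto simp: dvd_add_left_iff)
qed

lemma center_class3_group:
  assumes "p > 1" and "odd p"
  shows "center (class3_group p) = {0} \<times> {0} \<times> {0} \<times> {0..<int p} \<times> {0..<int p}"
proof (intro equalityI subsetI)
  fix s :: "int \<times> int \<times> int \<times> int \<times> int"
  assume "s \<in> {0} \<times> {0} \<times> {0} \<times> {0..<int p} \<times> {0..<int p}"
  then show "s \<in> center (class3_group p)"
    using assms unfolding center_def centralizer_def
    by (auto simp: class3_group_commute_iff) (auto simp: class3_group_def)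
next
  fix s :: "int \<times> int \<times> int \<times> int \<times> int"
  assume s: "s \<in> center (class3_group p)"
  obtain x y z d e where eq: "s = (x, y, z, d, e)" by (metis prod_cases5)
  have car: "s \<in> carrier (class3_group p)"
    and com: "\<And>t. t \<in> carrier (class3_group p) \<Longrightarrow>
      s \<otimes>\<^bsub>class3_group p\<^esub> t = t \<otimes>\<^bsub>class3_group p\<^esub> s"
    using s by (auto simp: center_def centralizer_def)
  \<comment> \<open>Commuting with the generator \<open>X\<close> forces \<open>y\<close> and
    \<open>z\<close> to vanish modulo \<open>p\<close>; commuting with \<open>Y\<close> forces
    \<open>x\<close> to vanish.\<close>
  have "(1, 0, 0, 0, 0) \<in> carrier (class3_group p)" "(0, 1, 0, 0, 0) \<in> carrier (class3_group p)"
    using assms by (auto simp: class3_group_def)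
  from this[THEN com] have "int p dvd x" "int p dvd y" "int p dvd z"
    unfolding eq using assms by (simp_all add: class3_group_commute_iff)
  with car show "s \<in> {0} \<times> {0} \<times> {0} \<times> {0..<int p} \<times> {0..<int p}"
    unfolding eq by (auto simp: class3_group_def dvd_eq_mod_eq_0)
qed

section \<open>Centralizers of non-central elements\<close>

lemma eq_if_dvd_mult_diff:
  fixes a b v m :: int
  assumes "prime m" "v \<in> {0..<m}" "v \<noteq> 0" "a \<in> {0..<m}" "b \<in> {0..<m}" "m dvd v * (a - b)"
  shows "a = b"
proof -
  have "\<not> m dvd v" using assms by (simp add: dvd_eq_mod_eq_0)
  with assms have "m dvd a - b" by (auto simp: prime_dvd_mult_iff)
  with assms show ?thesis by (auto simp flip: mod_eq_dvd_iff)
qed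

text \<open>Modulo the center, the centralizer lies on the line spanned by \<open>(x, y, z)\<close>.
  A coordinate in which \<open>s\<close> is nonzero therefore determines the other two, which leaves
  three free coordinates in all.\<close>

lemma card_centralizer_class3_group_le:
  assumes "prime p" "odd p"
    and s: "s \<in> carrier (class3_group p) - center (class3_group p)"
  shows "card (centralizer (class3_group p) {s}) \<le> p ^ 3"
proof -
  obtain x y z d e where eq: "s = (x, y, z, d, e)" by (metis prod_cases5)
  have p: "prime (int p)" using assms by simp
  have "p > 1" using \<open>prime p\<close> by (rule prime_gt_1_nat)
  define I where "I = {0..<int p}"
  let ?C = "centralizer (class3_group p) {s}"
  have C: "x' \<in> I \<and> y' \<in> I \<and> z' \<in> I \<and> d' \<in> I \<and> e' \<in> I \<and>
      int p dvd x * y' - x' * y \<and> int p dvd x * z' - x' * z \<and> int p dvd z * y' - z' * y"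
    if "(x', y', z', d', e') \<in> ?C" for x' y' z' d' e'
  proof -
    have "s \<otimes>\<^bsub>class3_group p\<^esub> (x', y', z', d', e') = (x', y', z', d', e') \<otimes>\<^bsub>class3_group p\<^esub> s"
      "(x', y', z', d', e') \<in> carrier (class3_group p)"
      using that by (simp_all add: centralizer_def)
    then show ?thesis
      unfolding eq class3_group_commute_iff[OF \<open>odd p\<close>] by (simp add: I_def class3_group_def)
  qed
  \<comment> \<open>Here \<open>w\<close> selects the coordinate that parametrizes the line.\<close>
  have card_le: "card ?C \<le> p ^ 3"
    if "inj_on (\<lambda>(x', y', z', d', e'). (w x' y' z', d', e')) ?C"
      and w: "\<And>x' y' z'. x' \<in> I \<Longrightarrow> y' \<in> I \<Longrightarrow> z' \<in> I \<Longrightarrow> w x' y' z' \<in> I"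
    for w :: "int \<Rightarrow> int \<Rightarrow> int \<Rightarrow> int"
  proof -
    have "card ?C \<le> card (I \<times> I \<times> I)"
      using that(1) by (rule card_inj_on_le) (auto simp: I_def[symmetric] w dest!: C, simp add: I_def)
    also have "\<dots> = p ^ 3" by (simp add: I_def card_cartesian_product power3_eq_cube)
    finally show ?thesis .
  qed
  \<comment> \<open>For two points of the centralizer that share the selected coordinate, a minor
    changes by \<open>v\<close> times the difference in another coordinate, where \<open>v\<close>
    is the nonzero coordinate of \<open>s\<close>.\<close>
  have lin: "a = b"
    if "v \<in> I" "v \<noteq> 0" "a \<in> I" "b \<in> I" "int p dvd m" "int p dvd n" "m - n = v * (a - b)"
    for v a b m n
    using eq_if_dvd_mult_diff[OF p, of v a b] that dvd_diff[of "int p" m n] unfolding I_def by metis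
  have xyz: "x \<in> I" "y \<in> I" "z \<in> I" "x \<noteq> 0 \<or> y \<noteq> 0 \<or> z \<noteq> 0"
    using s \<open>p > 1\<close> \<open>odd p\<close> unfolding eq
    by (auto simp: center_class3_group) (auto simp: class3_group_def I_def)
  from xyz(4) consider "x \<noteq> 0" | "y \<noteq> 0" | "z \<noteq> 0" by blast
  then show ?thesis
  proof cases
    case 1
    have "inj_on (\<lambda>(x', y', z', d', e'). (x', d', e')) ?C"
    proof (rule inj_onI, clarsimp)
      fix x' y' z' d' e' y'' z''
      assume "(x', y', z', d', e') \<in> ?C" "(x', y'', z'', d', e') \<in> ?C"
      note C[OF this(1)] C[OF this(2)]
      then show "y' = y'' \<and> z' = z''"
        using lin[OF xyz(1) 1, of y' y'' "x * y' - x' * y" "x * y'' - x' * y"]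
          lin[OF xyz(1) 1, of z' z'' "x * z' - x' * z" "x * z'' - x' * z"]
        by (auto simp: algebra_simps)
    qed
    then show ?thesis by (rule card_le)
  next
    case 2
    have "inj_on (\<lambda>(x', y', z', d', e'). (y', d', e')) ?C"
    proof (rule inj_onI, clarsimp)
      fix x' y' z' d' e' x'' z''
      assume "(x', y', z', d', e') \<in> ?C" "(x'', y', z'', d', e') \<in> ?C"
      note C[OF this(1)] C[OF this(2)]
      then show "x' = x'' \<and> z' = z''"
        \<comment> \<open>The minors are listed in the order that makes their difference
          \<open>y * (x' - x'')\<close> with a positive sign.\<close>
        using lin[OF xyz(2) 2, of x' x'' "x * y' - x'' * y" "x * y' - x' * y"]
          lin[OF xyz(2) 2, of z' z'' "z * y' - z'' * y" "z * y' - z' * y"]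
        by (auto simp: algebra_simps)
    qed
    then show ?thesis by (rule card_le)
  next
    case 3
    have "inj_on (\<lambda>(x', y', z', d', e'). (z', d', e')) ?C"
    proof (rule inj_onI, clarsimp)
      fix x' y' z' d' e' x'' y''
      assume "(x', y', z', d', e') \<in> ?C" "(x'', y'', z', d', e') \<in> ?C"
      note C[OF this(1)] C[OF this(2)]
      then show "x' = x'' \<and> y' = y''"
        using lin[OF xyz(3) 3, of x' x'' "x * z' - x'' * z" "x * z' - x' * z"]
          lin[OF xyz(3) 3, of y' y'' "z * y' - z' * y" "z * y'' - z' * y"]
        by (auto simp: algebra_simps)
    qed
    then show ?thesis by (rule card_le)
  qed
qed

theorem corollary2p2:
  fixes p :: nat
  assumes "prime p" and "odd p"
  shows "\<exists>P :: nat monoid. group P \<and> \<not> comm_group P \<and> order P = p ^ 5 \<and>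
           cd_lattice P = {center P, carrier P}"
proof -
  let ?G = "class3_group p"
  \<comment> \<open>The claim asks for natural numbers as elements, so the 5-tuples are encoded
    injectively.\<close>
  let ?f = "to_nat :: int \<times> int \<times> int \<times> int \<times> int \<Rightarrow> nat"
  define P where "P = image_group ?f ?G"
  have "p > 1" using \<open>prime p\<close> by (rule prime_gt_1_nat)
  interpret G: group ?G using \<open>p > 1\<close> by (intro group_class3_group) simp
  have inj: "inj_on ?f A" for A using inj_to_nat by (rule inj_on_subset) simp
  interpret P: group P unfolding P_def by (rule G.group_image_group[OF inj])
  have carP: "carrier P = ?f ` carrier ?G" by (simp add: P_def image_group_carrier)
  have cenP: "center P = ?f ` center ?G" by (simp add: P_def G.center_image_group[OF inj])
  have ord: "order P = p ^ 5"
    by (simp add: order_def carP card_image[OF inj])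
      (simp add: class3_group_def card_cartesian_product power_def numeral_eq_Suc)
  have cardZ: "card (center P) = p ^ 2"
    using \<open>p > 1\<close> \<open>odd p\<close>
    by (simp add: cenP card_image[OF inj] center_class3_group card_cartesian_product power2_eq_square)
  have "cd_lattice P = {center P, carrier P}"
  proof (rule P.cd_lattice_eq_center_carrier)
    show "finite (carrier P)" by (simp add: carP class3_group_def)
    \<comment> \<open>This reads \<open>p ^ 6 < p ^ 7\<close>.\<close>
    show "p ^ 3 * p ^ 3 < order P * card (center P)"
      using \<open>p > 1\<close> by (simp add: ord cardZ flip: power_add)
    fix x assume "x \<in> carrier P - center P"
    then obtain s where s: "s \<in> carrier ?G - center ?G" "x = ?f s"
      unfolding carP cenP by blast
    then have "centralizer P {x} = ?f ` centralizer ?G {s}"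
      using G.centralizer_image_group[OF inj, of "{s}"] by (simp add: P_def)
    then show "card (centralizer P {x}) \<le> p ^ 3"
      using card_centralizer_class3_group_le[OF assms s(1)] by (simp add: card_image[OF inj])
  qed
  moreover have "\<not> comm_group P"
  proof
    assume "comm_group P"
    \<comment> \<open>The orders \<open>p ^ 2\<close> and \<open>p ^ 5\<close> would then have to
      agree.\<close>
    then have "center P = carrier P"
      by (auto simp: center_def centralizer_def comm_group_def intro: comm_monoid.m_comm)
    then show False using ord cardZ \<open>p > 1\<close> by (simp add: order_def)
  qed
  ultimately show ?thesis using ord P.group_axioms by blast
qed

end
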